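(* Let $q$ be an odd prime. The following three identities hold, where $\lambda$ ranges over elements of $\mathbb{F}_q$ subject to the indicated restrictions: 1) $\displaystyle\sum_{\lambda\ne 0,1}a_\lambda(q)+\phi(-1)=-1$; 2) $\displaystyle\sum_{\lambda\ne 0,-1}\phi(1+\lambda)\,a'_\lambda(q)^2+q+q^2\;{}_3F_2(1)=-1$; 3) $\displaystyle\sum_{\lambda\ne 0,-1}\phi(\lambda)\,a'_\lambda(q)^2+q\,\phi(-1)+q^2\;{}_3F_2(1)=-\phi(-1)$.
   Context: $\mathbb{F}_q$ is the finite field with $q$ elements; $\epsilon$ and $\phi$ are the trivial and quadratic multiplicative characters of $\mathbb{F}_q$. Every multiplicative character $\chi$ (including $\epsilon$) is extended to $\mathbb{F}_q$ by $\chi(0)=0$; $\overline{\chi}$ is the inverse character. For multiplicative characters $A,B$: $J(A,B)=\sum_{x\in\mathbb{F}_q}A(x)B(1-x)$ and $\binom{A}{B}=\frac{B(-1)}{q}J(A,\overline{B})$. For $x\in\mathbb{F}_q$, $${}_3F_2(x):={}_3F_2\left(\begin{matrix}\phi & \phi & \phi\\ & \epsilon & \epsilon\end{matrix}\ \middle|\ x\right)=\frac{q}{q-1}\sum_{\chi}\binom{\phi\chi}{\chi}^{3}\chi(x),$$ the sum running over all multiplicative characters $\chi$ of $\mathbb{F}_q$. For $\lambda\in\mathbb{F}_q\setminus\{0,1\}$, $a_\lambda(q)$ is the trace of Frobenius over $\mathbb{F}_q$ of the Legendre elliptic curve $E_\lambda:y^2=x(x-1)(x-\lambda)$, i.e.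 $a_\lambda(q)=q+1-\#E_\lambda(\mathbb{F}_q)$. For $\lambda\in\mathbb{F}_q\setminus\{0,-1\}$, $a'_\lambda(q)$ is the trace of Frobenius over $\mathbb{F}_q$ of the Clausen elliptic curve $E'_\lambda:y^2=(x-1)(x^2+\lambda)$, i.e. $a'_\lambda(q)=q+1-\#E'_\lambda(\mathbb{F}_q)$. *)

theory Defs
  imports Complex_Main "HOL-Library.Cardinality" "HOL-Computational_Algebra.Primes"
begin

text \<open>The finite field with \<open>q\<close> elements is a type \<open>'a :: {field, finite}\<close> with
  \<open>q = CARD('a)\<close>.\<close>

text \<open>Every multiplicative character, the trivial one included, is extended by \<open>\<chi> 0 = 0\<close>.
  For finite \<open>'a\<close> there are only finitely many characters, since their values on nonzero
  elements are roots of unity of order dividing \<open>CARD('a) - 1\<close>; so sums over all characters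
  are genuine finite sums.\<close>

definition mult_character :: "('a::{field,finite} \<Rightarrow> complex) \<Rightarrow> bool" where
  "mult_character \<chi> \<longleftrightarrow> \<chi> 0 = 0 \<and> \<chi> 1 = 1 \<and> (\<forall>x y. \<chi> (x * y) = \<chi> x * \<chi> y)"

definition quad_char :: "'a::{field,finite} \<Rightarrow> complex" where
  "quad_char x = (if x = 0 then 0 else if \<exists>y. x = y\<^sup>2 then 1 else -1)"

text \<open>Since \<open>inverse 0 = 0\<close>, pointwise inversion respects the convention \<open>\<chi> 0 = 0\<close>.\<close>

definition char_inv :: "('a::{field,finite} \<Rightarrow> complex) \<Rightarrow> 'a \<Rightarrow> complex" where
  "char_inv \<chi> x = inverse (\<chi> x)"

definition char_mult :: "('a::{field,finite} \<Rightarrow> complex) \<Rightarrow> ('a \<Rightarrow> complex) \<Rightarrow> 'a \<Rightarrow> complex" where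
  "char_mult A B x = A x * B x"

definition jacobi_sum :: "('a::{field,finite} \<Rightarrow> complex) \<Rightarrow> ('a \<Rightarrow> complex) \<Rightarrow> complex" where
  "jacobi_sum A B = (\<Sum>x\<in>UNIV. A x * B (1 - x))"

definition char_binom :: "('a::{field,finite} \<Rightarrow> complex) \<Rightarrow> ('a \<Rightarrow> complex) \<Rightarrow> complex" where
  "char_binom A B = B (-1) / of_nat CARD('a) * jacobi_sum A (char_inv B)"

text \<open>Greene's function with upper parameters \<open>\<phi>, \<phi>, \<phi>\<close> and lower parameters
  \<open>\<epsilon>, \<epsilon>\<close>.\<close>

definition hyp_3F2 :: "'a::{field,finite} \<Rightarrow> complex" where
  "hyp_3F2 x = of_nat CARD('a) / (of_nat CARD('a) - 1) *
     (\<Sum>\<chi> | mult_character \<chi>. char_binom (char_mult quad_char \<chi>) \<chi> ^ 3 * \<chi> x)"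

text \<open>Points over \<open>'a\<close> of the projective curve \<open>y\<^sup>2 = f(x)\<close> with \<open>f\<close> a monic cubic;
  \<open>None\<close> is its unique point at infinity.\<close>

definition curve_points :: "('a::{field,finite} \<Rightarrow> 'a) \<Rightarrow> ('a \<times> 'a) option set" where
  "curve_points f = insert None (Some ` {(x, y). y\<^sup>2 = f x})"

definition frobenius_trace :: "('a::{field,finite} \<Rightarrow> 'a) \<Rightarrow> int" where
  "frobenius_trace f = int CARD('a) + 1 - int (card (curve_points f))"

definition legendre_trace :: "'a::{field,finite} \<Rightarrow> int" where
  "legendre_trace l = frobenius_trace (\<lambda>x. x * (x - 1) * (x - l))"

definition clausen_trace :: "'a::{field,finite} \<Rightarrow> int" where
  "clausen_trace l = frobenius_trace (\<lambda>x. (x - 1) * (x\<^sup>2 + l))"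

end

(* Write phi for the quadratic character, A(l) for the sum of phi((x-1)(x^2+l)) over x, so that
   A(l) = -a'_l, and K for the sum of phi(a(a-1)b(b-1)(b-a)) over a and b.

   Orthogonality of characters turns q^2 3F2(1) into K. Exchanging a and b gives phi(-1) K = K.

   Expanding the sum of phi(l) A(l)^2 into a sum over l, x, y and substituting y = t x, l = x y v,
   the sum over x becomes a quadratic one, with value q [t = 1] - phi(t) - 1. What remains is a
   combination of the sums g(t) of phi(v(tv+1)(v+t)) over v; two substitutions of the form
   u = x + 1/x show that the phi(t) g(t) add up to K. This gives the third identity.

   The second follows because the curves at l and -1-l are 2-isogenous up to a quadratic
   twist. The first is an interchange of summation. *)

theory Submission
  imports Defs "HOL-Algebra.Multiplicative_Group"
begin

section \<open>The multiplicative group\<close>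

lemma one_less_card_field: "1 < CARD('a::{field,finite})"
proof -
  have "card {0, 1 :: 'a} \<le> CARD('a)"
    by (rule card_mono) auto
  then show ?thesis by simp
qed

text \<open>The record \<open>R\<close> presents the type as a field with carrier
  \<open>UNIV\<close>, so that the theorem on cyclic multiplicative groups of finite fields applies
  to it.\<close>

lemma ex_generator:
  "\<exists>g::'a::{field,finite}. g \<noteq> 0 \<and> (\<forall>x. x \<noteq> 0 \<longrightarrow> (\<exists>k. x = g ^ k))"
proof -
  define R :: "'a ring"
    where "R = \<lparr>carrier = UNIV, mult = (*), one = 1, zero = 0, add = (+)\<rparr>"
  have sel [simp]: "carrier R = UNIV" "mult R = (*)" "one R = 1" "zero R = 0" "add R = (+)"
    by (simp_all add: R_def)
  have "field R"
  proof (rule cring.cring_fieldI2)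
    show "cring R"
    proof (rule cringI)
      show "abelian_group R"
        by (rule abelian_groupI) (auto simp: algebra_simps intro: exI[of _ "- _"])
      show "Group.comm_monoid R"
        by (rule comm_monoidI) (auto simp: algebra_simps)
    qed (simp add: algebra_simps)
    show "\<zero>\<^bsub>R\<^esub> \<noteq> \<one>\<^bsub>R\<^esub>" by simp
    show "\<exists>b\<in>carrier R. a \<otimes>\<^bsub>R\<^esub> b = \<one>\<^bsub>R\<^esub>" if "a \<noteq> \<zero>\<^bsub>R\<^esub>" for a
      using that by (auto intro!: exI[of _ "inverse a"])
  qed
  then interpret field R .
  have pow: "a [^]\<^bsub>R\<^esub> (k::nat) = a ^ k" for a k
    by (induction k) (simp_all add: nat_pow_Suc mult.commute)
  obtain g where g: "g \<in> carrier (mult_of R)"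
      "carrier (mult_of R) = {g [^]\<^bsub>R\<^esub> i |i::nat. i \<in> UNIV}"
    using finite_field_mult_group_has_gen by auto
  then show ?thesis
    by (intro exI[of _ g]) (auto simp: pow set_eq_iff)
qed

text \<open>Multiplication by x permutes the nonzero elements; their product thus acquires a factor
  x^(q-1) and yet stays the same.\<close>

lemma finite_field_power_eq_1:
  fixes x :: "'a::{field,finite}"
  assumes "x \<noteq> 0"
  shows "x ^ (CARD('a) - 1) = 1"
proof -
  let ?U = "UNIV - {0::'a}"
  have "(\<Prod>y\<in>?U. y) = (\<Prod>y\<in>?U. x * y)"
    using assms by (intro prod.reindex_bij_witness[of _ "\<lambda>y. x * y" "\<lambda>y. y / x"]) auto
  also have "\<dots> = x ^ card ?U * (\<Prod>y\<in>?U. y)"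
    by (simp add: prod.distrib)
  finally have "x ^ card ?U = 1"
    by simp
  then show ?thesis by (simp add: card_Diff_singleton)
qed

text \<open>The powers g^0, ..., g^(q-2) exhaust the q-1 nonzero elements and are therefore
  distinct, which determines exponents modulo q-1.\<close>

lemma ex_primitive_element:
  obtains g :: "'a::{field,finite}" where "g \<noteq> 0" "\<And>x. x \<noteq> 0 \<Longrightarrow> \<exists>k. x = g ^ k"
    "\<And>i j. g ^ i = g ^ j \<Longrightarrow> i mod (CARD('a) - 1) = j mod (CARD('a) - 1)"
proof -
  let ?n = "CARD('a) - 1"
  obtain g :: 'a where g: "g \<noteq> 0" "\<And>x. x \<noteq> 0 \<Longrightarrow> \<exists>k. x = g ^ k"
    using ex_generator by blast
  have n: "?n > 0"
    using one_less_card_field[where ?'a = 'a] by simp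
  have md: "g ^ i = g ^ (i mod ?n)" for i
  proof -
    have "g ^ i = g ^ (?n * (i div ?n) + i mod ?n)" by simp
    also have "\<dots> = g ^ (i mod ?n)"
      unfolding power_add power_mult finite_field_power_eq_1[OF g(1)] by simp
    finally show ?thesis .
  qed
  have img: "(\<lambda>i. g ^ i) ` {..<?n} = UNIV - {0}"
  proof (intro equalityI subsetI)
    fix x assume "x \<in> UNIV - {0 :: 'a}"
    then obtain k where "x = g ^ k" using g by auto
    then show "x \<in> (\<lambda>i. g ^ i) ` {..<?n}"
      using md[of k] n by auto
  qed (use g in auto)
  have "inj_on (\<lambda>i. g ^ i) {..<?n}"
    by (rule eq_card_imp_inj_on) (simp, simp only: img card_Diff_singleton[OF UNIV_I] card_lessThan)
  then have "i mod ?n = j mod ?n" if "g ^ i = g ^ j" for i j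
    using that md[of i] md[of j] n by (auto dest: inj_onD)
  with g show ?thesis using that by blast
qed

section \<open>Orthogonality of multiplicative characters\<close>

lemma mult_character_0: "mult_character \<chi> \<Longrightarrow> \<chi> 0 = 0"
  and mult_character_1: "mult_character \<chi> \<Longrightarrow> \<chi> 1 = 1"
  and mult_character_mult: "mult_character \<chi> \<Longrightarrow> \<chi> (x * y) = \<chi> x * \<chi> y"
  by (simp_all add: mult_character_def)

lemma mult_character_inverse:
  assumes "mult_character \<chi>"
  shows "\<chi> (inverse x) = inverse (\<chi> x)"
proof (cases "x = 0")
  case False
  then have "\<chi> x * \<chi> (inverse x) = 1"
    using assms mult_character_mult[OF assms, of x "inverse x"] by (simp add: mult_character_1)
  then show ?thesis
    by (metis inverse_unique)
qed (simp add: mult_character_0 assms)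

lemma mult_character_power:
  "mult_character \<chi> \<Longrightarrow> \<chi> (x ^ n) = \<chi> x ^ n"
  by (induction n) (auto simp: mult_character_1 mult_character_mult)

lemma mult_character_neq_0:
  assumes "mult_character \<chi>" "x \<noteq> 0"
  shows "\<chi> x \<noteq> 0"
  using mult_character_mult[OF assms(1), of x "inverse x"] assms by (auto simp: mult_character_1)

text \<open>All values are 0 or (q-1)-th roots of unity. Finiteness matters because
  \<open>sum\<close> over an infinite set is 0 by convention.\<close>

lemma finite_mult_characters: "finite {\<chi> :: 'a::{field,finite} \<Rightarrow> complex. mult_character \<chi>}"
proof -
  let ?n = "CARD('a) - 1"
  have "finite {z::complex. z ^ ?n = 1}"
    using one_less_card_field[where ?'a = 'a] by (intro finite_roots_unity) simp
  then have "finite (PiE (UNIV :: 'a set) (\<lambda>_. insert 0 {z::complex. z ^ ?n = 1}))"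
    by (intro finite_PiE) auto
  moreover have "{\<chi> :: 'a \<Rightarrow> complex. mult_character \<chi>} \<subseteq> PiE UNIV (\<lambda>_. insert 0 {z. z ^ ?n = 1})"
    by (auto simp: mult_character_0 simp flip: mult_character_power)
       (metis finite_field_power_eq_1 mult_character_0 mult_character_1 mult_character_power One_nat_def)
  ultimately show ?thesis by (rule rev_finite_subset)
qed

text \<open>The character sends a primitive element g to a primitive root of unity \<open>w\<close>
  of order q-1. Since t = g^k with k not divisible by q-1, its value w^k differs from 1.\<close>

lemma ex_mult_character_neq_1:
  fixes t :: "'a::{field,finite}"
  assumes "t \<noteq> 0" "t \<noteq> 1"
  shows "\<exists>\<chi>. mult_character \<chi> \<and> \<chi> t \<noteq> 1"
proof -
  let ?n = "CARD('a) - 1"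
  obtain g :: 'a where g: "g \<noteq> 0" "\<And>x. x \<noteq> 0 \<Longrightarrow> \<exists>k. x = g ^ k"
    "\<And>i j. g ^ i = g ^ j \<Longrightarrow> i mod ?n = j mod ?n"
    using ex_primitive_element by metis
  have n: "?n > 0"
    using one_less_card_field[where ?'a = 'a] by simp
  define w where "w = cis (2 * pi / real ?n)"
  have w: "w ^ i = cis (2 * pi * real i / real ?n)" for i
    by (simp only: w_def DeMoivre) (simp add: mult_ac)
  have w1: "w ^ ?n = 1"
    using n by (subst w) simp
  have md: "w ^ i = w ^ (i mod ?n)" for i
  proof -
    have "w ^ i = w ^ (?n * (i div ?n) + i mod ?n)" by simp
    also have "\<dots> = w ^ (i mod ?n)"
      unfolding power_add power_mult w1 by simp
    finally show ?thesis .
  qed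
  \<comment> \<open>The choice of exponent is harmless: two exponents of the same element agree
    modulo q-1, and \<open>w\<close> to the power q-1 is 1.\<close>
  define \<chi> where "\<chi> x = (if x = 0 then 0 else w ^ (SOME k. x = g ^ k))" for x
  have \<chi>: "\<chi> (g ^ k) = w ^ k" for k
  proof -
    have "g ^ k = g ^ (SOME j. g ^ k = g ^ j)"
      by (rule someI) (rule refl)
    then show ?thesis
      using g md by (metis \<chi>_def power_not_zero)
  qed
  have "mult_character \<chi>"
    unfolding mult_character_def
  proof (intro conjI allI)
    show "\<chi> 1 = 1" using \<chi>[of 0] by simp
    fix x y
    show "\<chi> (x * y) = \<chi> x * \<chi> y"
    proof (cases "x = 0 \<or> y = 0")
      case False
      then obtain i j where "x = g ^ i" "y = g ^ j" using g by metis
      then show ?thesis by (simp add: \<chi> flip: power_add)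
    qed (auto simp: \<chi>_def)
  qed (simp add: \<chi>_def)
  moreover obtain k where k: "t = g ^ k" using g assms by metis
  have "k mod ?n \<noteq> 0"
  proof
    assume "k mod ?n = 0"
    then obtain m where "k = ?n * m" by auto
    then have "t = 1"
      using finite_field_power_eq_1[OF g(1)] by (simp only: k power_mult power_one)
    with assms show False by simp
  qed
  have "w ^ (k mod ?n) \<noteq> 1"
  proof
    assume "w ^ (k mod ?n) = 1"
    moreover have "w ^ 0 = 1" by simp
    moreover have "inj_on (\<lambda>k. cis (2 * pi * real k / real ?n)) {..<?n}"
      using bij_betw_roots_unity[OF n] by (simp add: bij_betw_def)
    ultimately show False
      using \<open>k mod ?n \<noteq> 0\<close> n unfolding w
      by (metis inj_onD lessThan_iff mod_less_divisor)
  qed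
  then have "\<chi> t \<noteq> 1" using k \<chi> md by metis
  ultimately show ?thesis by blast
qed

text \<open>Multiplication by a character \<open>\<psi>\<close> with \<open>\<psi> t\<close> other
  than 1 permutes the characters and scales the sum by \<open>\<psi> t\<close>.\<close>

lemma sum_mult_characters_eq_0:
  fixes t :: "'a::{field,finite}"
  assumes "t \<noteq> 1"
  shows "(\<Sum>\<chi> | mult_character \<chi>. \<chi> t) = 0"
proof (cases "t = 0")
  case False
  obtain \<psi> :: "'a \<Rightarrow> complex" where \<psi>: "mult_character \<psi>" "\<psi> t \<noteq> 1"
    using ex_mult_character_neq_1 False assms by blast
  have "(\<Sum>\<chi> | mult_character \<chi>. \<chi> t) = (\<Sum>\<chi> | mult_character \<chi>. \<psi> t * \<chi> t)"
    (is "?l = ?r")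
  proof (rule sum.reindex_bij_witness[of _ "\<lambda>\<chi> x. \<psi> x * \<chi> x" "\<lambda>\<chi> x. \<chi> x / \<psi> x"])
    fix \<chi> :: "'a \<Rightarrow> complex" assume "\<chi> \<in> Collect mult_character"
    then have \<chi>: "mult_character \<chi>" by simp
    \<comment> \<open>At the point 0, where \<open>\<psi>\<close> vanishes, both sides are 0 because
      \<open>\<chi> 0 = 0\<close>.\<close>
    show "(\<lambda>x. \<psi> x * (\<chi> x / \<psi> x)) = \<chi>" "(\<lambda>x. \<psi> x * \<chi> x / \<psi> x) = \<chi>"
      using mult_character_neq_0[OF \<psi>(1)] \<chi> \<psi>(1)
      by (auto simp: fun_eq_iff mult_character_0) (metis mult_character_0)+
    show "(\<lambda>x. \<chi> x / \<psi> x) \<in> Collect mult_character" "(\<lambda>x. \<psi> x * \<chi> x) \<in> Collect mult_character"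
      using \<chi> \<psi>(1) by (auto simp: mult_character_def)
    show "\<psi> t * (\<chi> t / \<psi> t) = \<chi> t"
      using mult_character_neq_0[OF \<psi>(1) False] by simp
  qed
  also have "?r = \<psi> t * ?l"
    by (simp only: sum_distrib_left)
  finally have "?l = \<psi> t * ?l" .
  with \<psi>(2) show ?thesis by simp
qed (simp add: mult_character_0)

text \<open>The dual argument: here the points are permuted, by x -> c x, instead of the
  characters.\<close>

lemma sum_mult_character_eq_0:
  fixes \<chi> :: "'a::{field,finite} \<Rightarrow> complex"
  assumes "mult_character \<chi>" "c \<noteq> 0" "\<chi> c \<noteq> 1"
  shows "(\<Sum>x\<in>UNIV. \<chi> x) = 0"
proof -
  have "(\<Sum>x\<in>UNIV. \<chi> x) = (\<Sum>x\<in>UNIV. \<chi> (c * x))"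
    using assms(2) by (intro sum.reindex_bij_witness[of _ "\<lambda>y. c * y" "\<lambda>y. y / c"]) auto
  also have "\<dots> = \<chi> c * (\<Sum>x\<in>UNIV. \<chi> x)"
    by (simp add: mult_character_mult assms(1) sum_distrib_left)
  finally show ?thesis using assms(3) by simp
qed

text \<open>Double counting of \<open>\<Sum>\<^sub>\<chi> \<Sum>\<^sub>t \<chi> t\<close>.\<close>

lemma card_mult_characters:
  "of_nat (card {\<chi> :: 'a::{field,finite} \<Rightarrow> complex. mult_character \<chi>}) = (of_nat CARD('a) - 1 :: complex)"
proof -
  let ?X = "{\<chi> :: 'a \<Rightarrow> complex. mult_character \<chi>}"
  define e :: "'a \<Rightarrow> complex" where "e x = (if x = 0 then 0 else 1)" for x
  have e: "e \<in> ?X" by (auto simp: e_def mult_character_def)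
  have "of_nat (card ?X) = (\<Sum>\<chi>\<in>?X. \<chi> 1)"
    by (simp add: mult_character_1)
  also have "\<dots> = (\<Sum>t\<in>UNIV. \<Sum>\<chi>\<in>?X. \<chi> t)"
    by (subst sum.remove[of UNIV 1]) (simp_all add: sum_mult_characters_eq_0)
  also have "\<dots> = (\<Sum>\<chi>\<in>?X. \<Sum>t\<in>UNIV. \<chi> t)"
    by (rule sum.swap)
  \<comment> \<open>In this order of summation only the trivial character \<open>e\<close> survives,
    with sum q-1.\<close>
  also have "\<dots> = (\<Sum>t\<in>UNIV. e t) + (\<Sum>\<chi>\<in>?X - {e}. \<Sum>t\<in>UNIV. \<chi> t)"
    by (rule sum.remove[OF finite_mult_characters e])
  also have "(\<Sum>\<chi>\<in>?X - {e}. \<Sum>t\<in>UNIV. \<chi> t) = 0"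
  proof (rule sum.neutral, rule ballI)
    fix \<chi> assume \<chi>: "\<chi> \<in> ?X - {e}"
    then have "\<exists>c. c \<noteq> 0 \<and> \<chi> c \<noteq> 1"
      by (auto simp: fun_eq_iff e_def mult_character_0 split: if_splits)
    then show "(\<Sum>t\<in>UNIV. \<chi> t) = 0"
      using \<chi> sum_mult_character_eq_0 by blast
  qed
  also have "(\<Sum>t\<in>UNIV. e t) = of_nat CARD('a) - 1"
    by (subst sum.remove[of UNIV 0]) (simp_all add: e_def card_Diff_singleton of_nat_diff)
  finally show ?thesis by simp
qed

lemma sum_mult_characters:
  fixes t :: "'a::{field,finite}"
  shows "(\<Sum>\<chi> | mult_character \<chi>. \<chi> t) = (if t = 1 then of_nat CARD('a) - 1 else 0)"
  by (auto simp: sum_mult_characters_eq_0 mult_character_1 card_mult_characters)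

section \<open>The quadratic character\<close>

text \<open>Translation by 1 permutes the field, so q times 1 is 0; with q = 2k+1 and 2 = 0 this
  would read 1 = 0.\<close>

lemma two_neq_zero_if_odd_card:
  assumes "odd CARD('a::{field,finite})"
  shows "(2::'a) \<noteq> 0"
proof
  assume 2: "(2::'a) = 0"
  have "(\<Sum>x::'a\<in>UNIV. x) = (\<Sum>x::'a\<in>UNIV. x + 1)"
    by (intro sum.reindex_bij_witness[of _ "\<lambda>y. y + 1" "\<lambda>y. y - 1"]) auto
  then have "of_nat CARD('a) = (0::'a)"
    by (simp add: sum.distrib)
  moreover obtain k where "CARD('a) = 2 * k + 1"
    using assms by (auto elim: oddE)
  ultimately show False using 2 by simp
qed

lemma quad_char_0 [simp]: "quad_char 0 = 0"
  by (simp add: quad_char_def)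

lemma quad_char_square: "x \<noteq> 0 \<Longrightarrow> quad_char (x\<^sup>2) = 1"
  by (auto simp: quad_char_def)

lemma quad_char_1 [simp]: "quad_char 1 = 1"
  using quad_char_square[of 1] by simp

lemma quad_char_idem: "x \<noteq> 0 \<Longrightarrow> quad_char x * quad_char x = 1"
  by (auto simp: quad_char_def)

text \<open>This is K. The \<open>itself\<close> argument records the field, which the complex value
  does not mention.\<close>

definition kernel_sum :: "'a::{field,finite} itself \<Rightarrow> complex" where
  "kernel_sum _ = (\<Sum>a::'a\<in>UNIV. \<Sum>b\<in>UNIV. quad_char (a * (a - 1) * b * (b - 1) * (b - a)))"

definition clausen_sum :: "'a::{field,finite} \<Rightarrow> complex" where
  "clausen_sum l = (\<Sum>x\<in>UNIV. quad_char ((x - 1) * (x\<^sup>2 + l)))"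

text \<open>This is g(t): for nonzero x and t it equals the sum of phi(l(l+x^2)(l+t^2x^2)) over l,
  through l = x^2 t v, and so depends on t alone.\<close>

definition fibre_sum :: "'a::{field,finite} \<Rightarrow> complex" where
  "fibre_sum t = (\<Sum>v\<in>UNIV. quad_char (v * (t * v + 1) * (v + t)))"

section \<open>The quadratic character in odd characteristic\<close>

context
  assumes odd_card: "odd CARD('a::{field,finite})"
begin

lemma two_neq_0 [simp]: "(2::'a) \<noteq> 0"
  using two_neq_zero_if_odd_card odd_card by blast

lemma four_neq_0 [simp]: "(4::'a) \<noteq> 0"
proof -
  have "(4::'a) = 2 * 2" by simp
  then show ?thesis by (metis two_neq_0 mult_eq_0_iff)
qed

text \<open>On powers of a primitive element phi(g^k) = (-1)^k. An odd power is no square because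
  q-1 is even, so the parity of an exponent is well defined.\<close>

lemma quad_char_mult: "quad_char (x * y :: 'a) = quad_char x * quad_char y"
proof -
  obtain g :: 'a where g: "g \<noteq> 0" "\<And>x. x \<noteq> 0 \<Longrightarrow> \<exists>k. x = g ^ k"
    "\<And>i j. g ^ i = g ^ j \<Longrightarrow> i mod (CARD('a) - 1) = j mod (CARD('a) - 1)"
    using ex_primitive_element by metis
  have pow: "quad_char (g ^ k) = (-1) ^ k" for k
  proof (cases "even k")
    case True
    then show ?thesis
      using g(1) quad_char_square[of "g ^ (k div 2)"] by (auto simp flip: power_mult)
  next
    case False
    have "g ^ k \<noteq> y\<^sup>2" for y
    proof
      assume y: "g ^ k = y\<^sup>2"
      then have "y \<noteq> 0" using g(1) by (auto simp: power2_eq_square)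
      then obtain j where "y = g ^ j" using g(2) by blast
      then have "k mod (CARD('a) - 1) = (j * 2) mod (CARD('a) - 1)"
        using y by (intro g(3)) (simp add: power_mult)
      moreover have "2 dvd CARD('a) - 1" using odd_card by simp
      ultimately have "even k \<longleftrightarrow> even (j * 2)"
        by (metis dvd_mod_iff)
      with False show False by simp
    qed
    then show ?thesis using False g(1) by (auto simp: quad_char_def)
  qed
  show ?thesis
  proof (cases "x = 0 \<or> y = 0")
    case False
    then obtain i j where "x = g ^ i" "y = g ^ j" using g(2) by metis
    then show ?thesis by (simp add: pow flip: power_add)
  qed auto
qed

lemma quad_char_mult_square: "x \<noteq> 0 \<Longrightarrow> quad_char (x\<^sup>2 * y :: 'a) = quad_char y"
  by (simp add: quad_char_mult quad_char_square)

lemma quad_char_inverse: "quad_char (inverse x :: 'a) = quad_char x"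
proof (cases "x = 0")
  case False
  have "quad_char (inverse x) = quad_char ((inverse x)\<^sup>2 * x)"
    using False by (simp add: power2_eq_square mult.assoc)
  then show ?thesis using False by (simp add: quad_char_mult_square del: power_inverse)
qed simp

lemma quad_char_divide: "quad_char (x / y :: 'a) = quad_char x * quad_char y"
  by (simp add: divide_inverse quad_char_mult quad_char_inverse)

lemma card_sqrts: "of_nat (card {y::'a. y\<^sup>2 = x}) = 1 + quad_char x"
proof (cases "\<exists>y. x = y\<^sup>2")
  case True
  then obtain y where y: "x = y\<^sup>2" by blast
  have "{z. z\<^sup>2 = x} = {y, -y}"
    by (auto simp: y power2_eq_iff)
  moreover have "y = -y \<longleftrightarrow> y = 0"
    using two_neq_0 by (metis add_eq_0_iff mult_2 mult_eq_0_iff)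
  ultimately show ?thesis
    by (cases "y = 0") (auto simp: y quad_char_square)
next
  case False
  then have "{z. z\<^sup>2 = x} = {}" "x \<noteq> 0" by force+
  with False show ?thesis by (simp add: quad_char_def)
qed

section \<open>Sums of phi over linear and quadratic polynomials\<close>

lemma sum_quad_char: "(\<Sum>x::'a\<in>UNIV. quad_char x) = 0"
proof -
  \<comment> \<open>Each y is counted once, at its square; hence the numbers 1 + phi(x) add up to
    q.\<close>
  have "(\<Sum>x\<in>UNIV. card {y::'a. y\<^sup>2 = x}) = card (\<Union>x\<in>UNIV. {y::'a. y\<^sup>2 = x})"
    by (rule card_UN_disjoint [symmetric]) auto
  also have "(\<Union>x\<in>UNIV. {y::'a. y\<^sup>2 = x}) = UNIV" by auto
  finally have "(\<Sum>x\<in>UNIV. of_nat (card {y::'a. y\<^sup>2 = x})) = (of_nat CARD('a) :: complex)"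
    by (metis of_nat_sum)
  then show ?thesis by (simp add: card_sqrts sum.distrib)
qed

lemma sum_quad_char_linear:
  fixes a b :: 'a
  assumes "a \<noteq> 0"
  shows "(\<Sum>x\<in>UNIV. quad_char (a * x + b)) = 0"
proof -
  have "(\<Sum>x\<in>UNIV. quad_char (a * x + b)) = (\<Sum>x::'a\<in>UNIV. quad_char x)"
    using assms by (intro sum.reindex_bij_witness[of _ "\<lambda>y. (y - b) / a" "\<lambda>x. a * x + b"]) auto
  then show ?thesis by (simp add: sum_quad_char)
qed

text \<open>For distinct r and s the product may be replaced by the quotient (x-r)/(x-s). This
  Moebius map carries the complement of s onto the complement of 1, leaving the full sum 0 minus
  phi(1).\<close>

lemma sum_quad_char_quadratic:
  fixes r s :: 'a
  shows "(\<Sum>x\<in>UNIV. quad_char ((x - r) * (x - s))) = (if r = s then of_nat CARD('a) else 0) - 1"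
proof (cases "r = s")
  case True
  have "(\<Sum>x\<in>UNIV. quad_char ((x - r) * (x - s))) = (\<Sum>x\<in>UNIV. quad_char ((x - s)\<^sup>2))"
    by (simp add: True power2_eq_square)
  also have "\<dots> = (\<Sum>x\<in>UNIV - {s}. quad_char ((x - s)\<^sup>2))"
    by (subst sum.remove[of UNIV s]) auto
  also have "\<dots> = (\<Sum>x\<in>UNIV - {s}. 1)"
    by (intro sum.cong) (auto intro!: quad_char_square)
  finally show ?thesis by (simp add: True card_Diff_singleton of_nat_diff Suc_le_eq)
next
  case False
  have "(\<Sum>x\<in>UNIV. quad_char ((x - r) * (x - s))) = (\<Sum>x\<in>UNIV - {s}. quad_char ((x - r) * (x - s)))"
    by (subst sum.remove[of UNIV s]) auto
  also have "\<dots> = (\<Sum>y\<in>UNIV - {1::'a}. quad_char y)"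
  proof (rule sum.reindex_bij_witness[of _ "\<lambda>y. s + (s - r) / (y - 1)" "\<lambda>x. (x - r) / (x - s)"])
    fix x assume x: "x \<in> UNIV - {s}"
    then have "(x - r) / (x - s) - 1 = (s - r) / (x - s)"
      by (simp add: field_simps)
    then show "s + (s - r) / ((x - r) / (x - s) - 1) = x"
      using x False by simp
    show "quad_char ((x - r) / (x - s)) = quad_char ((x - r) * (x - s))"
      by (simp add: quad_char_mult quad_char_divide)
    show "(x - r) / (x - s) \<in> UNIV - {1}"
      using x False by (auto simp: divide_eq_eq)
  next
    fix y :: 'a assume y: "y \<in> UNIV - {1}"
    then have "s + (s - r) / (y - 1) - r = (s - r) / (y - 1) * y"
      by (simp add: field_simps)
    then show "(s + (s - r) / (y - 1) - r) / (s + (s - r) / (y - 1) - s) = y"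
      using y False by simp
    show "s + (s - r) / (y - 1) \<in> UNIV - {s}"
      using y False by auto
  qed
  also have "\<dots> = -1"
    using sum_quad_char sum.remove[of UNIV "1::'a" quad_char] by (simp add: add_eq_0_iff)
  finally show ?thesis using False by simp
qed

text \<open>The equation x + b/x = u is quadratic in x with discriminant u^2 - 4b, so the fibre over
  u has 1 + phi(u^2 - 4b) points.\<close>

lemma sum_add_divide:
  fixes F :: "'a \<Rightarrow> complex" and b :: 'a
  assumes "b \<noteq> 0"
  shows "(\<Sum>x\<in>UNIV - {0}. F (x + b / x)) = (\<Sum>u\<in>UNIV. F u * (1 + quad_char (u\<^sup>2 - 4 * b)))"
proof -
  have c: "of_nat (card {x \<in> UNIV - {0}. x + b / x = u}) = 1 + quad_char (u\<^sup>2 - 4 * b)" for u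
  proof -
    \<comment> \<open>Completing the square. The value x = 0 is no root of the quadratic since b is
      nonzero.\<close>
    have iff: "x \<noteq> 0 \<and> x + b / x = u \<longleftrightarrow> (2 * x - u)\<^sup>2 = u\<^sup>2 - 4 * b" for x
    proof -
      have "x \<noteq> 0 \<and> x + b / x = u \<longleftrightarrow> x * x + b - u * x = 0"
        using assms by (cases "x = 0") (auto simp: field_simps)
      also have "\<dots> \<longleftrightarrow> 4 * (x * x + b - u * x) = 0"
        by (simp only: mult_eq_0_iff four_neq_0 simp_thms)
      also have "4 * (x * x + b - u * x) = (2 * x - u)\<^sup>2 - (u\<^sup>2 - 4 * b)"
        by (simp add: power2_eq_square algebra_simps)
      finally show ?thesis by simp
    qed
    have "bij_betw (\<lambda>x. 2 * x - u) {x \<in> UNIV - {0}. x + b / x = u} {y. y\<^sup>2 = u\<^sup>2 - 4 * b}"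
      by (rule bij_betwI[of _ _ _ "\<lambda>y. (y + u) / 2"]) (auto simp: iff simp del: distrib_left_numeral)
    then have "card {x \<in> UNIV - {0}. x + b / x = u} = card {y. y\<^sup>2 = u\<^sup>2 - 4 * b}"
      by (rule bij_betw_same_card)
    then show ?thesis by (simp only: card_sqrts)
  qed
  have "(\<Sum>x\<in>UNIV - {0}. F (x + b / x)) =
      (\<Sum>u\<in>UNIV. \<Sum>x\<in>{x \<in> UNIV - {0}. x + b / x = u}. F (x + b / x))"
    by (rule sum.group [symmetric]) auto
  also have "\<dots> = (\<Sum>u\<in>UNIV. F u * of_nat (card {x \<in> UNIV - {0}. x + b / x = u}))"
    by (intro sum.cong) auto
  finally show ?thesis by (simp only: c)
qed

lemma quad_char_uminus: "quad_char (- x :: 'a) = quad_char (-1::'a) * quad_char x"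
  using quad_char_mult[of "-1" x] by simp

lemma sum_nonzero: "(\<Sum>x\<in>UNIV - {0::'a}. F x) = (\<Sum>x\<in>UNIV. F x) - (F 0 :: complex)"
  by (subst sum.remove[of UNIV "0::'a"]) auto

section \<open>Reduction of the hypergeometric value\<close>

text \<open>The exchange of variables reverses only the factor b - a. In particular K = 0 if phi(-1)
  = -1, which is why the second and third identities can share the same K.\<close>

lemma kernel_sum_swap: "quad_char (-1::'a) * kernel_sum TYPE('a) = kernel_sum TYPE('a)"
proof -
  have "kernel_sum TYPE('a) =
      (\<Sum>a::'a\<in>UNIV. \<Sum>b\<in>UNIV. quad_char (b * (b - 1) * a * (a - 1) * (a - b)))"
    unfolding kernel_sum_def by (rule sum.swap)
  also have "\<dots> = (\<Sum>a::'a\<in>UNIV. \<Sum>b\<in>UNIV. quad_char (-1::'a) * quad_char (a * (a - 1) * b * (b - 1) * (b - a)))"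
    by (intro sum.cong refl, subst quad_char_uminus [symmetric])
       (simp add: algebra_simps)
  also have "\<dots> = quad_char (-1::'a) * kernel_sum TYPE('a)"
    by (simp only: kernel_sum_def sum_distrib_left)
  finally show ?thesis by simp
qed

text \<open>The substitution is z = x/(x-1), for which z - 1 = 1/(x-1), so that z(z-1) is x times a
  square. The factor \<open>\<chi> (-1)\<close> turns 1 - x into x - 1.\<close>

lemma char_binom_quad_char:
  fixes \<chi> :: "'a \<Rightarrow> complex"
  assumes "mult_character \<chi>"
  shows "char_binom (char_mult quad_char \<chi>) \<chi> =
    (\<Sum>z\<in>UNIV. quad_char (z * (z - 1)) * \<chi> z) / of_nat CARD('a)"
proof -
  have "\<chi> (-1) * jacobi_sum (char_mult quad_char \<chi>) (char_inv \<chi>) =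
      (\<Sum>x\<in>UNIV. quad_char x * \<chi> (x / (x - 1)))"
    unfolding jacobi_sum_def char_mult_def char_inv_def sum_distrib_left
  proof (intro sum.cong refl)
    fix x :: 'a
    have "inverse (1 - x) = - inverse (x - 1)"
      by (metis inverse_minus_eq minus_diff_eq)
    then have "\<chi> (x / (x - 1)) = \<chi> (- 1 * (x * inverse (1 - x)))"
      by (simp add: divide_inverse)
    then show "\<chi> (-1) * (quad_char x * \<chi> x * inverse (\<chi> (1 - x))) = quad_char x * \<chi> (x / (x - 1))"
      by (simp only: mult_character_mult[OF assms] mult_character_inverse[OF assms] mult_ac)
  qed
  \<comment> \<open>At x = 1 division by zero yields \<open>\<chi> 0 = 0\<close>.\<close>
  also have "\<dots> = (\<Sum>x\<in>UNIV - {1}. quad_char x * \<chi> (x / (x - 1)))"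
    by (subst sum.remove[of UNIV 1]) (auto simp: mult_character_0 assms)
  also have "\<dots> = (\<Sum>z\<in>UNIV - {1}. quad_char (z * (z - 1)) * \<chi> z)"
  proof (rule sum.reindex_bij_witness[of _ "\<lambda>x. x / (x - 1)" "\<lambda>x. x / (x - 1)"])
    fix x :: 'a assume x: "x \<in> UNIV - {1}"
    then have e: "x / (x - 1) - 1 = 1 / (x - 1)"
      by (simp add: field_simps)
    \<comment> \<open>The map is its own inverse, so both directions of the bijection pose the same
      goals; hence the repetition.\<close>
    then show "x / (x - 1) / (x / (x - 1) - 1) = x" "x / (x - 1) / (x / (x - 1) - 1) = x"
      using x by auto
    have "x / (x - 1) - 1 \<noteq> 0"
      using x by (simp add: e)
    then show "x / (x - 1) \<in> UNIV - {1}" "x / (x - 1) \<in> UNIV - {1}"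
      by auto
    have "x / (x - 1) * (x / (x - 1) - 1) = (inverse (x - 1))\<^sup>2 * x"
      by (simp add: e) (simp add: divide_inverse power2_eq_square)
    then show "quad_char (x / (x - 1) * (x / (x - 1) - 1)) * \<chi> (x / (x - 1)) =
        quad_char x * \<chi> (x / (x - 1))"
      using x by (simp add: quad_char_mult_square del: power_inverse)
  qed
  also have "\<dots> = (\<Sum>z\<in>UNIV. quad_char (z * (z - 1)) * \<chi> z)"
    by (rule sum.mono_neutral_left) auto
  finally show ?thesis by (simp add: char_binom_def)
qed

text \<open>The cube expands into a sum over a, b, c, and summing over characters forces abc = 1.
  The factor q-1 produced this way cancels the denominator of \<open>hyp_3F2\<close>.\<close>

lemma hyp_3F2_1: "of_nat CARD('a) ^ 2 * hyp_3F2 (1::'a) = kernel_sum TYPE('a)"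
proof -
  define q where "q = (of_nat CARD('a) :: complex)"
  have q: "q \<noteq> 0" "q - 1 \<noteq> 0"
    using one_less_card_field[where ?'a = 'a] by (auto simp: q_def)
  define h :: "'a \<Rightarrow> complex" where "h z = quad_char (z * (z - 1))" for z
  have h0 [simp]: "h 0 = 0" by (simp add: h_def)
  have "(\<Sum>\<chi> | mult_character \<chi>. char_binom (char_mult quad_char \<chi>) \<chi> ^ 3 * \<chi> (1::'a)) =
      (\<Sum>\<chi> | mult_character \<chi>. (\<Sum>z::'a\<in>UNIV. h z * \<chi> z) ^ 3) / q ^ 3"
    by (subst sum_divide_distrib, intro sum.cong refl)
       (simp add: char_binom_quad_char mult_character_1 power_divide q_def h_def)
  also have "(\<Sum>\<chi> | mult_character \<chi>. (\<Sum>z::'a\<in>UNIV. h z * \<chi> z) ^ 3) =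
      (\<Sum>\<chi> | mult_character \<chi>. \<Sum>a::'a\<in>UNIV. \<Sum>b\<in>UNIV. \<Sum>c\<in>UNIV. h a * h b * h c * \<chi> (a * b * c))"
    by (intro sum.cong refl)
       (simp add: power3_eq_cube sum_distrib_left sum_distrib_right mult_character_mult mult_ac)
  also have "\<dots> = (\<Sum>a::'a\<in>UNIV. \<Sum>b\<in>UNIV. \<Sum>c\<in>UNIV. \<Sum>\<chi> | mult_character \<chi>. h a * h b * h c * \<chi> (a * b * c))"
    by (subst sum.swap, intro sum.cong refl, subst sum.swap, intro sum.cong refl, rule sum.swap)
  also have "\<dots> = (\<Sum>a::'a\<in>UNIV. \<Sum>b\<in>UNIV. (q - 1) * (h a * h b * h (inverse (a * b))))"
  proof (intro sum.cong refl)
    fix a b :: 'a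
    have "(\<Sum>c\<in>UNIV. \<Sum>\<chi> | mult_character \<chi>. h a * h b * h c * \<chi> (a * b * c)) =
        (\<Sum>c\<in>UNIV. if a * b * c = 1 then h a * h b * h c * (q - 1) else 0)"
      by (simp only: sum_distrib_left [symmetric] sum_mult_characters) (auto intro!: sum.cong simp: q_def)
    \<comment> \<open>If a or b is 0, no c satisfies abc = 1, and the right side vanishes too
      because \<open>h 0 = 0\<close>.\<close>
    also have "\<dots> = (q - 1) * (h a * h b * h (inverse (a * b)))"
    proof (cases "a = 0 \<or> b = 0")
      case False
      then have "a * b * c = 1 \<longleftrightarrow> c = inverse (a * b)" for c
        by (auto simp: field_simps)
      then show ?thesis by simp
    qed auto
    finally show "(\<Sum>c\<in>UNIV. \<Sum>\<chi> | mult_character \<chi>. h a * h b * h c * \<chi> (a * b * c)) = \<dots>" .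
  qed
  also have "\<dots> = (q - 1) * (\<Sum>a::'a\<in>UNIV. \<Sum>b\<in>UNIV. h a * h b * h (inverse (a * b)))"
    by (simp only: sum_distrib_left)
  \<comment> \<open>Inverting a turns the third argument into a/b; up to squares the arguments then
    become the polynomial of K.\<close>
  also have "(\<Sum>a::'a\<in>UNIV. \<Sum>b\<in>UNIV. h a * h b * h (inverse (a * b))) =
      (\<Sum>a::'a\<in>UNIV. \<Sum>b\<in>UNIV. h (inverse a) * h b * h (inverse (inverse a * b)))"
    by (rule sum.reindex_bij_witness[of _ inverse inverse]) auto
  also have "\<dots> = kernel_sum TYPE('a)"
    unfolding kernel_sum_def
  proof (intro sum.cong refl)
    fix a b :: 'a
    show "h (inverse a) * h b * h (inverse (inverse a * b)) =
        quad_char (a * (a - 1) * b * (b - 1) * (b - a))"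
    proof (cases "a = 0 \<or> b = 0")
      case False
      have "h (inverse a) * h b * h (inverse (inverse a * b)) = h (1 / a) * h b * h (a / b)"
        using False by (simp add: field_simps)
      also have "h (1 / a) = quad_char (1 - a)"
      proof -
        have "1 / a * (1 / a - 1) = (1 / a)\<^sup>2 * (1 - a)"
          using False by (simp add: field_simps power2_eq_square)
        then show ?thesis
          using False quad_char_mult_square[of "1 / a"] by (simp only: h_def) auto
      qed
      also have "h (a / b) = quad_char (a * (a - b))"
      proof -
        have "a / b * (a / b - 1) = (1 / b)\<^sup>2 * (a * (a - b))"
          using False by (simp add: field_simps power2_eq_square)
        then show ?thesis
          using False quad_char_mult_square[of "1 / b"] by (simp only: h_def) auto
      qed
      also have "quad_char (1 - a) * h b * quad_char (a * (a - b)) =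
          quad_char ((1 - a) * (b * (b - 1)) * (a * (a - b)))"
        by (simp only: h_def quad_char_mult)
      also have "(1 - a) * (b * (b - 1)) * (a * (a - b)) = a * (a - 1) * b * (b - 1) * (b - a)"
        by (simp add: algebra_simps)
      finally show ?thesis .
    qed auto
  qed
  finally show ?thesis
    using q by (simp add: hyp_3F2_def flip: q_def) (simp add: field_simps power2_eq_square power3_eq_cube)
qed

section \<open>Traces of Frobenius as character sums\<close>

text \<open>Over each x lie 1 + phi(f x) affine points, so q and the point at infinity cancel
  against q + 1.\<close>

lemma frobenius_trace_eq: "of_int (frobenius_trace (f :: 'a \<Rightarrow> 'a)) = - (\<Sum>x\<in>UNIV. quad_char (f x))"
proof -
  have "card (curve_points f) = Suc (card {(x, y). y\<^sup>2 = f x})"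
    unfolding curve_points_def by (subst card_insert_disjoint) (auto simp: card_image)
  also have "{(x, y). y\<^sup>2 = f x} = (SIGMA x:UNIV. {y. y\<^sup>2 = f x})"
    by auto
  also have "card \<dots> = (\<Sum>x\<in>UNIV. card {y. y\<^sup>2 = f x})"
    by (rule card_SigmaI) auto
  finally have "(of_nat (card (curve_points f)) :: complex) = 1 + (\<Sum>x\<in>UNIV. 1 + quad_char (f x))"
    by (simp add: card_sqrts)
  then show ?thesis
    by (simp add: frobenius_trace_def sum.distrib)
qed

lemma of_int_clausen_trace: "of_int (clausen_trace l) = - clausen_sum (l::'a)"
  by (simp add: clausen_trace_def frobenius_trace_eq clausen_sum_def)

text \<open>Over all l the sum vanishes, being linear in l for fixed x. The singular cubics at l = 0
  and l = 1 have a double root, and their sums -phi(-1) and -1 are split off.\<close>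

lemma sum_legendre_trace:
  "(\<Sum>l\<in>UNIV - {0, 1 :: 'a}. of_int (legendre_trace l)) + quad_char (-1 :: 'a) = -1"
proof -
  define L :: "'a \<Rightarrow> complex" where "L l = (\<Sum>x\<in>UNIV. quad_char (x * (x - 1) * (x - l)))" for l
  have "(-1 :: 'a) \<noteq> 0" by simp
  have "(\<Sum>l\<in>UNIV. L l) = (\<Sum>x::'a\<in>UNIV. \<Sum>l\<in>UNIV. quad_char (x * (x - 1) * (x - l)))"
    unfolding L_def by (rule sum.swap)
  also have "\<dots> = (\<Sum>x::'a\<in>UNIV. \<Sum>l\<in>UNIV. quad_char (x * (x - 1)) * quad_char ((-1) * l + x))"
    by (simp flip: quad_char_mult)
  also have "\<dots> = 0"
    by (simp only: sum_distrib_left [symmetric] sum_quad_char_linear[OF \<open>-1 \<noteq> 0\<close>]) simp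
  also have "(\<Sum>l\<in>UNIV. L l) = (\<Sum>l\<in>insert 0 (insert 1 (UNIV - {0, 1})). L l)"
    by (intro sum.cong) auto
  also have "\<dots> = L 0 + (L 1 + (\<Sum>l\<in>UNIV - {0, 1}. L l))"
    by (subst sum.insert, simp, simp, subst sum.insert) simp_all
  also have "L 0 = (\<Sum>x::'a\<in>UNIV - {0}. quad_char (x\<^sup>2 * (1 * x + - 1)))"
    by (subst sum_nonzero) (simp add: L_def power2_eq_square mult_ac)
  also have "\<dots> = (\<Sum>x\<in>UNIV - {0::'a}. quad_char (1 * x + - 1))"
    by (intro sum.cong refl quad_char_mult_square) auto
  also have "\<dots> = - quad_char (-1 :: 'a)"
    by (subst sum_nonzero, subst sum_quad_char_linear) auto
  also have "L 1 = (\<Sum>x::'a\<in>UNIV - {1}. quad_char ((x - 1)\<^sup>2 * x))"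
    unfolding L_def by (subst sum.remove[of UNIV 1]) (simp_all add: power2_eq_square mult_ac)
  also have "\<dots> = (\<Sum>x\<in>UNIV - {1::'a}. quad_char x)"
    by (intro sum.cong refl quad_char_mult_square) auto
  also have "\<dots> = -1"
    using sum_quad_char sum.remove[of UNIV "1::'a" quad_char] by (simp add: add_eq_0_iff)
  finally have "(\<Sum>l\<in>UNIV - {0, 1}. L l) = quad_char (-1 :: 'a) + 1"
    by (simp add: algebra_simps)
  then show ?thesis
    by (simp add: legendre_trace_def frobenius_trace_eq sum_negf flip: L_def)
qed

text \<open>\<open>E'\<^sub>l\<close> is 2-isogenous to a quadratic twist of \<open>E'\<close> at \<open>-1-l\<close>; on the character sums
  the isogeny is the substitution \<open>u = x - l / (4 x)\<close>.\<close>

lemma clausen_sum_isogeny: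
  assumes "(l::'a) \<noteq> 0"
  shows "(clausen_sum (-1 - l))\<^sup>2 = (clausen_sum l)\<^sup>2"
proof -
  \<comment> \<open>Chosen to make the discriminant u^2 - 4b equal to u^2 + l.\<close>
  define b where "b = - l / 4"
  have b: "b \<noteq> 0" "l = - (4 * b)"
    using assms by (auto simp: b_def)
  \<comment> \<open>The map x -> 1 - 2x moves the rational root 1 to 0 and turns the quadratic
    factor into 4(x^2 - x + b).\<close>
  have "clausen_sum (-1 - l) = (\<Sum>x\<in>UNIV. quad_char ((1 - 2 * x - 1) * ((1 - 2 * x)\<^sup>2 + (-1 - l))))"
    unfolding clausen_sum_def
    by (rule sum.reindex_bij_witness[of _ "\<lambda>x. 1 - 2 * x" "\<lambda>z. (1 - z) / 2"])
      (auto simp del: right_diff_distrib_numeral)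
  also have "\<dots> = (\<Sum>x\<in>UNIV. quad_char (2\<^sup>2 * ((-2) * (x * (x\<^sup>2 - x + b)))))"
    by (intro sum.cong refl arg_cong[of _ _ quad_char]) (simp add: b power2_eq_square algebra_simps)
  also have "\<dots> = quad_char (-2 :: 'a) * (\<Sum>x\<in>UNIV. quad_char (x * (x\<^sup>2 - x + b)))"
    by (simp only: quad_char_mult_square[OF two_neq_0] quad_char_mult[of "-2"] sum_distrib_left)
  also have "(\<Sum>x\<in>UNIV. quad_char (x * (x\<^sup>2 - x + b))) = (\<Sum>x\<in>UNIV - {0}. quad_char (x * (x\<^sup>2 - x + b)))"
    by (subst sum_nonzero) simp
  also have "\<dots> = (\<Sum>x\<in>UNIV - {0}. quad_char (x + b / x - 1))"
  proof (intro sum.cong refl)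
    fix x :: 'a assume "x \<in> UNIV - {0}"
    then have x: "x \<noteq> 0" by simp
    then have "x * (x\<^sup>2 - x + b) = x\<^sup>2 * (x + b / x - 1)"
      by (simp add: field_simps power2_eq_square)
    then show "quad_char (x * (x\<^sup>2 - x + b)) = quad_char (x + b / x - 1)"
      by (simp only: quad_char_mult_square[OF x])
  qed
  also have "\<dots> = (\<Sum>u\<in>UNIV. quad_char (u - 1) * (1 + quad_char (u\<^sup>2 - 4 * b)))"
    by (rule sum_add_divide[OF b(1)])
  also have "\<dots> = clausen_sum l"
    using sum_quad_char_linear[of 1 "-1"]
    by (simp add: clausen_sum_def distrib_left sum.distrib quad_char_mult b)
  \<comment> \<open>The twist contributes phi(-2), whose square is 1.\<close>
  finally show ?thesis
    using quad_char_idem[of "-2::'a"] by (simp add: power_mult_distrib) (simp add: power2_eq_square)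
qed

section \<open>The second moment of the Clausen traces\<close>

text \<open>The quadratic has leading coefficient t and roots 1 and 1/t; leaving out x = 0 subtracts
  phi(1) = 1.\<close>

lemma sum_quad_char_linear_product:
  assumes "(t::'a) \<noteq> 0"
  shows "(\<Sum>x\<in>UNIV - {0}. quad_char ((x - 1) * (t * x - 1))) =
    (if t = 1 then of_nat CARD('a) else 0) - quad_char t - 1"
proof -
  have "(\<Sum>x\<in>UNIV. quad_char ((x - 1) * (t * x - 1))) =
      (\<Sum>x\<in>UNIV. quad_char t * quad_char ((x - 1) * (x - 1 / t)))"
  proof (intro sum.cong refl)
    fix x :: 'a
    have "(x - 1) * (t * x - 1) = t * ((x - 1) * (x - 1 / t))"
      using assms by (simp add: field_simps)
    then show "quad_char ((x - 1) * (t * x - 1)) = quad_char t * quad_char ((x - 1) * (x - 1 / t))"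
      by (simp only: quad_char_mult)
  qed
  also have "\<dots> = quad_char t * ((if t = 1 then of_nat CARD('a) else 0) - 1)"
    using assms by (simp only: sum_distrib_left [symmetric] sum_quad_char_quadratic) auto
  finally show ?thesis
    by (subst sum_nonzero) (auto simp: algebra_simps)
qed

lemma fibre_sum_1: "fibre_sum (1::'a) = - quad_char (-1 :: 'a)"
proof -
  have "fibre_sum (1::'a) = (\<Sum>v::'a\<in>UNIV. quad_char ((v + 1)\<^sup>2 * v))"
    by (simp add: fibre_sum_def power2_eq_square mult_ac)
  also have "\<dots> = (\<Sum>v\<in>UNIV - {-1::'a}. quad_char ((v + 1)\<^sup>2 * v))"
    by (subst sum.remove[of UNIV "-1"]) auto
  also have "\<dots> = (\<Sum>v\<in>UNIV - {-1::'a}. quad_char v)"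
    by (intro sum.cong refl quad_char_mult_square) (auto simp: add_eq_0_iff2)
  also have "\<dots> = - quad_char (-1 :: 'a)"
    using sum_quad_char sum.remove[of UNIV "-1::'a" quad_char] by (simp add: add_eq_0_iff)
  finally show ?thesis .
qed

text \<open>As a polynomial in t the argument is v^2 (t+v)(t+1/v), with a double root exactly for v
  = 1 and v = -1. The total is 2q - (q-1) = q + 1, and t = 0 accounts for q - 1 of it.\<close>

lemma sum_fibre_sum: "(\<Sum>t\<in>UNIV - {0::'a}. fibre_sum t) = 2"
proof -
  have inner: "(\<Sum>t\<in>UNIV. quad_char (v * (t * v + 1) * (v + t))) =
      (if v \<in> {1, -1} then of_nat CARD('a) else 0) - 1" if v: "v \<noteq> 0" for v :: 'a
  proof -
    have "(\<Sum>t\<in>UNIV. quad_char (v * (t * v + 1) * (v + t))) =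
        (\<Sum>t\<in>UNIV. quad_char (v\<^sup>2 * ((t - (- v)) * (t - (- 1 / v)))))"
      using v by (intro sum.cong refl arg_cong[of _ _ quad_char]) (simp add: field_simps power2_eq_square)
    also have "\<dots> = (if - v = - 1 / v then of_nat CARD('a) else 0) - 1"
      by (simp only: quad_char_mult_square[OF v] sum_quad_char_quadratic)
    also have "- v = - 1 / v \<longleftrightarrow> v\<^sup>2 = 1"
      using v by (auto simp: field_simps power2_eq_square)
    finally show ?thesis by (simp add: power2_eq_1_iff)
  qed
  have "(1::'a) \<noteq> -1"
    using two_neq_0 by (metis add_eq_0_iff one_add_one)
  have "(\<Sum>t::'a\<in>UNIV. fibre_sum t) = (\<Sum>v\<in>UNIV. \<Sum>t\<in>UNIV. quad_char (v * (t * v + 1) * (v + t) :: 'a))"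
    unfolding fibre_sum_def by (rule sum.swap)
  also have "\<dots> = (\<Sum>v\<in>UNIV - {0}. \<Sum>t\<in>UNIV. quad_char (v * (t * v + 1) * (v + t) :: 'a))"
    by (subst sum_nonzero) simp
  also have "\<dots> = (\<Sum>v\<in>UNIV - {0::'a}. (if v \<in> {1, -1} then of_nat CARD('a) else 0) - 1)"
    by (intro sum.cong refl inner) auto
  also have "\<dots> = (\<Sum>v\<in>{1, -1::'a}. of_nat CARD('a)) - (of_nat CARD('a) - 1)"
  proof -
    have "(\<Sum>v\<in>UNIV - {0::'a}. if v \<in> {1, -1} then of_nat CARD('a) else (0::complex)) =
        (\<Sum>v\<in>{1, -1::'a}. of_nat CARD('a))"
      by (rule sum.mono_neutral_cong_right) auto
    then show ?thesis
      by (simp only: sum_subtractf) (simp add: card_Diff_singleton of_nat_diff Suc_le_eq)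
  qed
  also have "\<dots> = of_nat CARD('a) + 1"
    using \<open>1 \<noteq> -1\<close> by simp
  finally have "(\<Sum>t::'a\<in>UNIV. fibre_sum t) = of_nat CARD('a) + 1" .
  moreover have "fibre_sum (0::'a) = of_nat CARD('a) - 1"
    using sum_quad_char_quadratic[of 0 0] by (simp add: fibre_sum_def)
  ultimately show ?thesis
    by (subst sum_nonzero) simp
qed

text \<open>\<open>sum_add_divide\<close> is applied to u = v + 1/v and then to w = t + 1/t. The
  parts free of phi(u^2-4) or phi(w^2-4) vanish as linear sums, leaving
  phi((u^2-4)(w^2-4)(u+w)).\<close>

lemma sum_quad_char_fibre_sum:
  "(\<Sum>t\<in>UNIV - {0::'a}. quad_char t * fibre_sum t) = kernel_sum TYPE('a)"
proof -
  have fibre: "fibre_sum t = (\<Sum>u\<in>UNIV. quad_char (t * u + (1 + t\<^sup>2)) * (1 + quad_char (u\<^sup>2 - 4)))"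
    for t :: 'a
  proof -
    have "fibre_sum t = (\<Sum>v\<in>UNIV - {0}. quad_char (v * (t * v + 1) * (v + t)))"
      by (subst sum_nonzero) (simp add: fibre_sum_def)
    also have "\<dots> = (\<Sum>v\<in>UNIV - {0}. quad_char (t * (v + 1 / v) + (1 + t\<^sup>2)))"
    proof (intro sum.cong refl)
      fix v :: 'a assume "v \<in> UNIV - {0}"
      then have v: "v \<noteq> 0" by simp
      then have "v * (t * v + 1) * (v + t) = v\<^sup>2 * (t * (v + 1 / v) + (1 + t\<^sup>2))"
        by (simp add: field_simps power2_eq_square)
      then show "quad_char (v * (t * v + 1) * (v + t)) = quad_char (t * (v + 1 / v) + (1 + t\<^sup>2))"
        by (simp only: quad_char_mult_square[OF v])
    qed
    also have "\<dots> = (\<Sum>u\<in>UNIV. quad_char (t * u + (1 + t\<^sup>2)) * (1 + quad_char (u\<^sup>2 - 4 * 1)))"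
      by (rule sum_add_divide) simp
    finally show ?thesis by simp
  qed
  have sum_t: "(\<Sum>t\<in>UNIV - {0}. quad_char t * quad_char (t * u + (1 + t\<^sup>2))) =
      (\<Sum>w\<in>UNIV. quad_char (u + w) * quad_char (w\<^sup>2 - 4))" for u :: 'a
  proof -
    have "(\<Sum>t\<in>UNIV - {0}. quad_char t * quad_char (t * u + (1 + t\<^sup>2))) =
        (\<Sum>t\<in>UNIV - {0}. quad_char (u + (t + 1 / t)))"
    proof (intro sum.cong refl)
      fix t :: 'a assume "t \<in> UNIV - {0}"
      then have t: "t \<noteq> 0" by simp
      then have "t * (t * u + (1 + t\<^sup>2)) = t\<^sup>2 * (u + (t + 1 / t))"
        by (simp add: field_simps power2_eq_square)
      then show "quad_char t * quad_char (t * u + (1 + t\<^sup>2)) = quad_char (u + (t + 1 / t))"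
        by (simp only: quad_char_mult [symmetric] quad_char_mult_square[OF t])
    qed
    also have "\<dots> = (\<Sum>w\<in>UNIV. quad_char (u + w) * (1 + quad_char (w\<^sup>2 - 4 * 1)))"
      by (rule sum_add_divide) simp
    finally show ?thesis
      using sum_quad_char_linear[of 1 u] by (simp add: distrib_left sum.distrib add.commute)
  qed
  have "(\<Sum>t\<in>UNIV - {0::'a}. quad_char t * fibre_sum t) =
      (\<Sum>t\<in>UNIV - {0::'a}. \<Sum>u\<in>UNIV. quad_char t * quad_char (t * u + (1 + t\<^sup>2)) * (1 + quad_char (u\<^sup>2 - 4)))"
    by (simp only: fibre sum_distrib_left mult.assoc)
  also have "\<dots> = (\<Sum>u::'a\<in>UNIV. (\<Sum>t\<in>UNIV - {0::'a}. quad_char t * quad_char (t * u + (1 + t\<^sup>2))) * (1 + quad_char (u\<^sup>2 - 4)))"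
    by (subst sum.swap) (simp only: sum_distrib_right)
  also have "\<dots> = (\<Sum>u::'a\<in>UNIV. \<Sum>w\<in>UNIV. quad_char (u + w) * quad_char (w\<^sup>2 - 4)) +
      (\<Sum>u::'a\<in>UNIV. \<Sum>w\<in>UNIV. quad_char (u\<^sup>2 - 4) * quad_char (w\<^sup>2 - 4) * quad_char (u + w))"
    by (simp only: sum_t distrib_left sum.distrib mult_1_right sum_distrib_right) (simp only: mult_ac)
  also have "(\<Sum>u::'a\<in>UNIV. \<Sum>w\<in>UNIV. quad_char (u + w) * quad_char (w\<^sup>2 - 4)) =
      (\<Sum>w::'a\<in>UNIV. (\<Sum>u\<in>UNIV. quad_char (1 * u + w)) * quad_char (w\<^sup>2 - 4))"
    by (subst sum.swap) (simp only: sum_distrib_right mult_1)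
  also have "\<dots> = 0"
    by (simp only: sum_quad_char_linear[OF one_neq_zero]) simp
  \<comment> \<open>Here u = 2 - 4a, and next w = 4b - 2, move the roots 2 and -2 to 0 and 1; the
    opposite signs make u + w = 4(b - a).\<close>
  also have "(\<Sum>u::'a\<in>UNIV. \<Sum>w\<in>UNIV. quad_char (u\<^sup>2 - 4) * quad_char (w\<^sup>2 - 4) * quad_char (u + w)) =
      (\<Sum>a::'a\<in>UNIV. \<Sum>w\<in>UNIV. quad_char ((2 - 4 * a)\<^sup>2 - 4) * quad_char (w\<^sup>2 - 4) * quad_char (2 - 4 * a + w))"
    by (rule sum.reindex_bij_witness[of _ "\<lambda>a. 2 - 4 * a" "\<lambda>u. (2 - u) / 4"])
      (auto simp del: right_diff_distrib_numeral)
  also have "\<dots> = (\<Sum>a::'a\<in>UNIV. \<Sum>b\<in>UNIV. quad_char ((2 - 4 * a)\<^sup>2 - 4) * quad_char ((4 * b - 2)\<^sup>2 - 4) *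
      quad_char (2 - 4 * a + (4 * b - 2)))"
    by (rule sum.cong[OF refl], rule sum.reindex_bij_witness[of _ "\<lambda>b. 4 * b - 2" "\<lambda>w. (w + 2) / 4"])
      (auto simp del: distrib_left_numeral)
  also have "\<dots> = kernel_sum TYPE('a)"
    unfolding kernel_sum_def
  proof (intro sum.cong refl)
    fix a b :: 'a
    \<comment> \<open>The constant is 16 * 16 * 4 = 32^2, with 32 factored so that it is visibly
      nonzero.\<close>
    have "((2 - 4 * a)\<^sup>2 - 4) * ((4 * b - 2)\<^sup>2 - 4) * (2 - 4 * a + (4 * b - 2)) =
        (4 * (4 * 2))\<^sup>2 * (a * (a - 1) * b * (b - 1) * (b - a))"
      by (simp add: power2_eq_square algebra_simps)
    moreover have nz: "4 * (4 * 2) \<noteq> (0::'a)"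
      by (simp only: mult_eq_0_iff two_neq_0 four_neq_0 simp_thms)
    ultimately have "quad_char (((2 - 4 * a)\<^sup>2 - 4) * ((4 * b - 2)\<^sup>2 - 4) * (2 - 4 * a + (4 * b - 2))) =
        quad_char (a * (a - 1) * b * (b - 1) * (b - a))"
      by (simp only: quad_char_mult_square[OF nz])
    then show "quad_char ((2 - 4 * a)\<^sup>2 - 4) * quad_char ((4 * b - 2)\<^sup>2 - 4) * quad_char (2 - 4 * a + (4 * b - 2)) =
        quad_char (a * (a - 1) * b * (b - 1) * (b - a))"
      by (simp only: quad_char_mult)
  qed
  finally show ?thesis by simp
qed

text \<open>Pairs (x, y) with both entries nonzero give q g(1) - K - 2. The two axes without the
  origin give 1 each, cancelling the -2, and the origin gives 0.\<close>

lemma sum_quad_char_clausen_sum: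
  "(\<Sum>l\<in>UNIV. quad_char l * (clausen_sum (l::'a))\<^sup>2) =
    - of_nat CARD('a) * quad_char (-1 :: 'a) - kernel_sum TYPE('a)"
proof -
  define G :: "'a \<Rightarrow> 'a \<Rightarrow> complex" where "G x y = (\<Sum>l\<in>UNIV. quad_char (l * (l + x\<^sup>2) * (l + y\<^sup>2)))" for x y
  define P where "P x y = quad_char (x - 1) * quad_char (y - 1) * G x y" for x y
  have P_commute: "P x y = P y x" for x y
    by (simp add: P_def G_def mult_ac)
  have "(\<Sum>l\<in>UNIV. quad_char l * (clausen_sum (l::'a))\<^sup>2) =
      (\<Sum>l::'a\<in>UNIV. \<Sum>x\<in>UNIV. \<Sum>y\<in>UNIV. quad_char (x - 1) * quad_char (y - 1) * quad_char (l * (l + x\<^sup>2) * (l + y\<^sup>2)))"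
    by (intro sum.cong refl, simp only: clausen_sum_def power2_eq_square sum_product,
        simp only: sum_distrib_left) (simp add: quad_char_mult mult_ac add.commute)
  also have "\<dots> = (\<Sum>x::'a\<in>UNIV. \<Sum>l\<in>UNIV. \<Sum>y\<in>UNIV. quad_char (x - 1) * quad_char (y - 1) * quad_char (l * (l + x\<^sup>2) * (l + y\<^sup>2)))"
    by (rule sum.swap)
  also have "\<dots> = (\<Sum>x\<in>UNIV. \<Sum>y\<in>UNIV. P x y)"
    unfolding P_def G_def sum_distrib_left by (rule sum.cong[OF refl], rule sum.swap)
  \<comment> \<open>The factor 2 comes from the symmetry of \<open>P\<close>, which identifies the
    two axes.\<close>
  also have "\<dots> = (\<Sum>x\<in>UNIV - {0}. \<Sum>y\<in>UNIV - {0}. P x y) + 2 * (\<Sum>x\<in>UNIV - {0}. P x 0) + P 0 0"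
  proof -
    have "(\<Sum>y\<in>UNIV. P 0 y) = (\<Sum>y\<in>UNIV. P y 0)"
      by (intro sum.cong refl P_commute)
    then show ?thesis
      by (simp add: sum_nonzero sum_subtractf)
  qed
  also have "P 0 0 = 0"
  proof -
    have "quad_char (l * (l + 0\<^sup>2) * (l + 0\<^sup>2)) = quad_char l" for l :: 'a
      using quad_char_mult_square[of l l] by (cases "l = 0") (simp_all add: power2_eq_square mult_ac)
    then have "G 0 0 = 0"
      by (simp only: G_def sum_quad_char)
    then show ?thesis by (simp add: P_def)
  qed
  also have "(\<Sum>x\<in>UNIV - {0}. P x 0) = 1"
  proof -
    have G0: "G x 0 = -1" if x: "x \<noteq> 0" for x
    proof -
      have "G x 0 = (\<Sum>l\<in>UNIV - {0}. quad_char (l\<^sup>2 * (1 * l + x\<^sup>2)))"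
        by (subst sum_nonzero) (simp add: G_def power2_eq_square mult_ac)
      also have "\<dots> = (\<Sum>l\<in>UNIV - {0}. quad_char (1 * l + x\<^sup>2))"
        by (intro sum.cong refl quad_char_mult_square) auto
      also have "\<dots> = -1"
        by (subst sum_nonzero, subst sum_quad_char_linear) (auto simp: quad_char_square x)
      finally show ?thesis .
    qed
    have "(\<Sum>x\<in>UNIV - {0}. P x 0) = (\<Sum>x\<in>UNIV - {0::'a}. quad_char (1 * x + - 1)) * - quad_char (-1 :: 'a)"
      unfolding sum_distrib_right by (intro sum.cong refl) (simp add: P_def G0)
    also have "\<dots> = 1"
      by (subst sum_nonzero, subst sum_quad_char_linear) (auto simp: quad_char_idem)
    finally show ?thesis .
  qed
  also have "(\<Sum>x\<in>UNIV - {0}. \<Sum>y\<in>UNIV - {0}. P x y) = (\<Sum>x\<in>UNIV - {0}. \<Sum>t\<in>UNIV - {0}. P x (t * x))"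
  proof (rule sum.cong[OF refl])
    fix x :: 'a assume "x \<in> UNIV - {0}"
    then show "(\<Sum>y\<in>UNIV - {0}. P x y) = (\<Sum>t\<in>UNIV - {0}. P x (t * x))"
      by (intro sum.reindex_bij_witness[of _ "\<lambda>t. t * x" "\<lambda>y. y / x"]) auto
  qed
  also have "\<dots> = (\<Sum>x\<in>UNIV - {0::'a}. \<Sum>t\<in>UNIV - {0}. quad_char ((x - 1) * (t * x - 1)) * fibre_sum t)"
  proof (intro sum.cong refl)
    fix x t :: 'a assume "x \<in> UNIV - {0}" "t \<in> UNIV - {0}"
    then have xt: "x \<noteq> 0" "t \<noteq> 0" by auto
    have "G x (t * x) = (\<Sum>v\<in>UNIV. quad_char ((x\<^sup>2 * t * v) * (x\<^sup>2 * t * v + x\<^sup>2) * (x\<^sup>2 * t * v + (t * x)\<^sup>2)))"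
      unfolding G_def using xt
      by (intro sum.reindex_bij_witness[of _ "\<lambda>v. x\<^sup>2 * t * v" "\<lambda>l. l / (x\<^sup>2 * t)"]) auto
    \<comment> \<open>The extracted factor x^6 t^2 is a square, so x disappears from the
      sum.\<close>
    also have "\<dots> = (\<Sum>v\<in>UNIV. quad_char ((x ^ 3 * t)\<^sup>2 * (v * (t * v + 1) * (v + t))))"
      by (intro sum.cong refl arg_cong[of _ _ quad_char])
         (simp add: power2_eq_square power3_eq_cube algebra_simps)
    also have "\<dots> = fibre_sum t"
      unfolding fibre_sum_def using xt by (intro sum.cong refl quad_char_mult_square) simp
    finally show "P x (t * x) = quad_char ((x - 1) * (t * x - 1)) * fibre_sum t"
      by (simp add: P_def quad_char_mult)
  qed
  also have "\<dots> = (\<Sum>t\<in>UNIV - {0::'a}. (\<Sum>x\<in>UNIV - {0}. quad_char ((x - 1) * (t * x - 1))) * fibre_sum t)"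
    by (subst sum.swap) (simp only: sum_distrib_right)
  \<comment> \<open>The three terms of the x-sum are summed separately: they yield q g(1), K and the
    total 2 of \<open>sum_fibre_sum\<close>.\<close>
  also have "\<dots> = (\<Sum>t\<in>UNIV - {0::'a}. (if t = 1 then of_nat CARD('a) * fibre_sum t else 0)
      - quad_char t * fibre_sum t - fibre_sum t)"
    by (intro sum.cong refl, subst sum_quad_char_linear_product) (auto simp: algebra_simps)
  also have "\<dots> = of_nat CARD('a) * fibre_sum (1::'a) - kernel_sum TYPE('a) - 2"
    by (simp add: sum_subtractf sum_quad_char_fibre_sum sum_fibre_sum)
  finally show ?thesis
    by (simp add: fibre_sum_1)
qed

text \<open>At l = -1 the cubic degenerates to (x-1)^2 (x+1), so the sum is a linear one without its
  term at x = 1.\<close>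

lemma clausen_sum_neg1: "clausen_sum (-1::'a) = - quad_char (2 :: 'a)"
proof -
  have "clausen_sum (-1::'a) = (\<Sum>x\<in>UNIV. quad_char ((x - 1)\<^sup>2 * (1 * x + 1) :: 'a))"
    unfolding clausen_sum_def
    by (intro sum.cong refl arg_cong[of _ _ quad_char]) (simp add: power2_eq_square algebra_simps)
  also have "\<dots> = (\<Sum>x\<in>UNIV - {1}. quad_char ((x - 1)\<^sup>2 * (1 * x + 1) :: 'a))"
    by (subst sum.remove[of UNIV 1]) auto
  also have "\<dots> = (\<Sum>x\<in>UNIV - {1}. quad_char (1 * x + 1 :: 'a))"
    by (intro sum.cong refl quad_char_mult_square) auto
  also have "\<dots> = - quad_char (2 :: 'a)"
    using sum_quad_char_linear[of 1 1] sum.remove[of UNIV "1::'a" "\<lambda>x. quad_char (1 * x + 1)"]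
    by (simp add: add_eq_0_iff)
  finally show ?thesis .
qed

text \<open>Of the two excluded values, l = 0 contributes nothing because phi(0) = 0, and l = -1
  contributes phi(-1) since phi(2)^2 = 1.\<close>

lemma sum_quad_char_clausen_trace:
  "(\<Sum>l\<in>UNIV - {0, -1 :: 'a}. quad_char l * of_int (clausen_trace l) ^ 2)
    + of_nat CARD('a) * quad_char (-1 :: 'a) + kernel_sum TYPE('a) = - quad_char (-1 :: 'a)"
proof -
  have "(\<Sum>l\<in>UNIV. quad_char l * (clausen_sum (l::'a))\<^sup>2) =
      (\<Sum>l\<in>insert (-1) (UNIV - {0, -1}). quad_char l * (clausen_sum (l::'a))\<^sup>2)"
    by (rule sum.mono_neutral_right) auto
  also have "\<dots> = quad_char (-1 :: 'a) + (\<Sum>l\<in>UNIV - {0, -1}. quad_char l * (clausen_sum (l::'a))\<^sup>2)"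
    using quad_char_idem[OF two_neq_0]
    by (subst sum.insert) (auto simp: clausen_sum_neg1 power2_eq_square)
  finally have "(\<Sum>l\<in>UNIV - {0, -1}. quad_char l * (clausen_sum (l::'a))\<^sup>2) =
      - of_nat CARD('a) * quad_char (-1 :: 'a) - kernel_sum TYPE('a) - quad_char (-1 :: 'a)"
    unfolding sum_quad_char_clausen_sum by (simp only: add_diff_cancel_left')
  then show ?thesis
    by (simp add: of_int_clausen_trace)
qed

text \<open>The involution l -> -1-l preserves the index set and, by the isogeny, the squared
  traces, while 1 + l becomes -l. So the sum is phi(-1) times the previous one, and phi(-1) K =
  K.\<close>

lemma sum_quad_char_clausen_trace_shift:
  "(\<Sum>l\<in>UNIV - {0, -1 :: 'a}. quad_char (1 + l) * of_int (clausen_trace l) ^ 2)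
    + of_nat CARD('a) + kernel_sum TYPE('a) = -1"
proof -
  let ?S = "\<Sum>l\<in>UNIV - {0, -1 :: 'a}. quad_char l * of_int (clausen_trace l) ^ 2"
  have "(\<Sum>l\<in>UNIV - {0, -1 :: 'a}. quad_char (1 + l) * of_int (clausen_trace l) ^ 2) =
      (\<Sum>l\<in>UNIV - {0, -1 :: 'a}. quad_char (- l) * of_int (clausen_trace l) ^ 2)"
  proof (rule sum.reindex_bij_witness[of _ "\<lambda>l. -1 - l" "\<lambda>l. -1 - l"])
    fix l :: 'a assume l: "l \<in> UNIV - {0, -1}"
    then show "quad_char (- (-1 - l)) * of_int (clausen_trace (-1 - l)) ^ 2 =
        quad_char (1 + l) * of_int (clausen_trace l) ^ 2"
      by (simp add: of_int_clausen_trace clausen_sum_isogeny add.commute)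
  qed (auto simp: algebra_simps)
  also have "\<dots> = quad_char (-1 :: 'a) * ?S"
    unfolding sum_distrib_left by (intro sum.cong refl) (subst quad_char_uminus, simp add: mult_ac)
  also have "?S = - quad_char (-1 :: 'a) - of_nat CARD('a) * quad_char (-1 :: 'a) - kernel_sum TYPE('a)"
    by (simp flip: sum_quad_char_clausen_trace)
  also have "quad_char (-1 :: 'a) * \<dots> = - 1 - of_nat CARD('a) - kernel_sum TYPE('a)"
    by (simp add: right_diff_distrib kernel_sum_swap quad_char_idem mult.left_commute)
  finally show ?thesis by simp
qed

end

theorem corollary4p4:
  fixes q :: nat
  assumes "CARD('a::{field,finite}) = q" and "prime q" and "odd q"
  shows "(\<Sum>l\<in>UNIV - {0, 1 :: 'a}. of_int (legendre_trace l)) + quad_char (-1 :: 'a) = -1 \<and>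
    (\<Sum>l\<in>UNIV - {0, -1 :: 'a}. quad_char (1 + l) * of_int (clausen_trace l) ^ 2)
      + of_nat q + of_nat q ^ 2 * hyp_3F2 (1 :: 'a) = -1 \<and>
    (\<Sum>l\<in>UNIV - {0, -1 :: 'a}. quad_char l * of_int (clausen_trace l) ^ 2)
      + of_nat q * quad_char (-1 :: 'a) + of_nat q ^ 2 * hyp_3F2 (1 :: 'a)
      = - quad_char (-1 :: 'a)"
proof -
  have odd: "odd CARD('a)" using assms by simp
  show ?thesis
    unfolding assms(1) [symmetric] hyp_3F2_1[OF odd]
    using sum_legendre_trace[OF odd] sum_quad_char_clausen_trace[OF odd]
      sum_quad_char_clausen_trace_shift[OF odd] by blast
qed

end
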